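(* Let $\mathcal{P}'$ be a subgrid polyomino of a grid polyomino $\mathcal{P}$. Then $I_{\mathcal{P}'}$ is a prime ideal.
   Context: **Polyominoes.** For $a=(i,j),b=(k,\ell)\in\mathbb{N}^2$ with $i\le k$, $j\le \ell$, the interval $[a,b]$ is $\{(r,s)\in\mathbb{N}^2: i\le r\le k,\ j\le s\le \ell\}$. It is proper if $i<k$ and $j<\ell$; then $a$ and $b$ are its diagonal corners, and $c=(i,\ell)$ and $d=(k,j)$ are its anti-diagonal corners. A cell is an interval $C=[a,a+(1,1)]$; its vertex set $V(C)$ consists of its four corners, and its edges are $\{a,a+(1,0)\}$, $\{a,a+(0,1)\}$, $\{a+(1,0),a+(1,1)\}$, $\{a+(0,1),a+(1,1)\}$. A polyomino is a finite collection $\mathcal{P}$ of cells such that any two cells $C,D$ of $\mathcal{P}$ are connected by a sequence of cells $C=C_1,\dots,C_m=D$ of $\mathcal{P}$ with $C_t\cap C_{t+1}$ an edge of $C_t$ for every $t<m$. Put $V(\mathcal{P})=\bigcup_{C\in\mathcal{P}}V(C)$. A proper interval $[a,b]$ is an inner interval of $\mathcal{P}$ if all cells contained in $[a,b]$ belong to $\mathcal{P}$; it is maximal if it is not strictly contained in another inner interval. A polyomino is thin if it contains no four cells forming a $2\times2$ square. **Polyomino ideal.** Let $\mathbb{K}$ be a field and $S=\mathbb{K}[x_v\mid v\in V(\mathcal{P})]$. $I_{\mathcal{P}}\subset S$ is the ideal generated by all inner 2-minors $x_ax_b-x_cx_d$, where $[a,b]$ ranges over the inner intervals of $\mathcal{P}$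 and $c,d$ are the anti-diagonal corners of $[a,b]$ (and similarly for $\mathcal{P}'$). **Grid polyomino.** Write $[r]=\{1,\dots,r\}$. A grid polyomino is a thin polyomino $\mathcal{P}\subseteq I:=[(1,1),(m,n)]$ of the form $\mathcal{P}=I\setminus\{\mathcal{H}_{ij}: i\in[r],\,j\in[s]\}$ (that is, the cells of $\mathcal{P}$ are the cells of $I$ not contained in any $\mathcal{H}_{ij}$), where $\mathcal{H}_{ij}=[a_{ij},b_{ij}]$ with $a_{ij}=((a_{ij})_1,(a_{ij})_2)$, $b_{ij}=((b_{ij})_1,(b_{ij})_2)$, $1<(a_{ij})_1<(b_{ij})_1<m$, $1<(a_{ij})_2<(b_{ij})_2<n$, and (1) for any $i\in[r]$ and $\ell,k\in[s]$: $(a_{i\ell})_1=(a_{ik})_1$ and $(b_{i\ell})_1=(b_{ik})_1$; (2) for any $j\in[s]$ and $\ell,k\in[r]$: $(a_{\ell j})_2=(a_{kj})_2$ and $(b_{\ell j})_2=(b_{kj})_2$; (3) for any $i\in[r-1]$ and $j\in[s-1]$: $(a_{i+1\,j})_1=(b_{ij})_1+1$ and $(a_{i\,j+1})_2=(b_{ij})_2+1$. **Subgrid polyomino.** A grid polyomino is a disjoint union $\mathcal{P}=\mathcal{P}_1\sqcup\mathcal{P}_2$, where $\mathcal{P}_1$ is the set of cells of $\mathcal{P}$ properly contained in exactly one maximal inner interval of $\mathcal{P}$, and $\mathcal{P}_2$ is the set of cells of $\mathcal{P}$ properly contained in two maximal inner intervals of $\mathcal{P}$. If $\mathcal{P}_1'\subseteq\mathcal{P}_1$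 is such that $\mathcal{P}'=\mathcal{P}\setminus\mathcal{P}_1'$ is a polyomino, then $\mathcal{P}'$ is called a subgrid polyomino of $\mathcal{P}$. *)

theory Defs
  imports "HOL-Algebra.Ideal" "HOL-Library.Poly_Mapping" "HOL-Library.Product_Plus"
begin

section \<open>Polyominoes\<close>

type_synonym point = "nat \<times> nat"

definition interval :: "point \<Rightarrow> point \<Rightarrow> point set" where
  "interval a b = {fst a..fst b} \<times> {snd a..snd b}"

text \<open>A cell is identified with its set of lattice points, which is also its vertex set, so that a
  collection of cells has type \<^typ>\<open>point set set\<close>.\<close>

definition cell :: "point \<Rightarrow> point set" where
  "cell a = interval a (a + (1, 1))"

definition cells :: "point set set" where
  "cells = range cell"

definition is_edge_of :: "point set \<Rightarrow> point set \<Rightarrow> bool" where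
  "is_edge_of E C \<longleftrightarrow> (\<exists>a. C = cell a \<and>
     E \<in> {{a, a + (1, 0)}, {a, a + (0, 1)},
          {a + (1, 0), a + (1, 1)}, {a + (0, 1), a + (1, 1)}})"

definition polyomino :: "point set set \<Rightarrow> bool" where
  "polyomino P \<longleftrightarrow> finite P \<and> P \<subseteq> cells \<and>
     (\<forall>C\<in>P. \<forall>D\<in>P. \<exists>cs. cs \<noteq> [] \<and> hd cs = C \<and> last cs = D \<and> set cs \<subseteq> P \<and>
        successively (\<lambda>A B. is_edge_of (A \<inter> B) A) cs)"

definition vertices :: "point set set \<Rightarrow> point set" where
  "vertices P = \<Union> P"

definition proper_interval :: "point \<Rightarrow> point \<Rightarrow> bool" where
  "proper_interval a b \<longleftrightarrow> fst a < fst b \<and> snd a < snd b"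

definition inner_interval :: "point set set \<Rightarrow> point \<Rightarrow> point \<Rightarrow> bool" where
  "inner_interval P a b \<longleftrightarrow> proper_interval a b \<and>
     (\<forall>C\<in>cells. C \<subseteq> interval a b \<longrightarrow> C \<in> P)"

definition inner_intervals :: "point set set \<Rightarrow> point set set" where
  "inner_intervals P = {interval a b |a b. inner_interval P a b}"

definition maximal_inner_intervals :: "point set set \<Rightarrow> point set set" where
  "maximal_inner_intervals P =
     {J \<in> inner_intervals P. \<not> (\<exists>J'\<in>inner_intervals P. J \<subset> J')}"

definition thin :: "point set set \<Rightarrow> bool" where
  "thin P \<longleftrightarrow> \<not> (\<exists>a. {cell a, cell (a + (1, 0)), cell (a + (0, 1)), cell (a + (1, 1))} \<subseteq> P)"


section \<open>Grid and subgrid polyominoes\<close>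

text \<open>The holes are \<open>interval (a i j) (b i j)\<close> for \<open>1 \<le> i \<le> r\<close> and \<open>1 \<le> j \<le> s\<close>.\<close>

definition grid_polyomino :: "point set set \<Rightarrow> bool" where
  "grid_polyomino P \<longleftrightarrow> polyomino P \<and> thin P \<and>
     (\<exists>(m::nat) (n::nat) (r::nat) (s::nat) (a :: nat \<Rightarrow> nat \<Rightarrow> point) (b :: nat \<Rightarrow> nat \<Rightarrow> point).
        P = {C \<in> cells. C \<subseteq> interval (1, 1) (m, n) \<and>
               (\<forall>i\<in>{1..r}. \<forall>j\<in>{1..s}. \<not> C \<subseteq> interval (a i j) (b i j))} \<and>
        (\<forall>i\<in>{1..r}. \<forall>j\<in>{1..s}.
           1 < fst (a i j) \<and> fst (a i j) < fst (b i j) \<and> fst (b i j) < m \<and>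
           1 < snd (a i j) \<and> snd (a i j) < snd (b i j) \<and> snd (b i j) < n) \<and>
        (\<forall>i\<in>{1..r}. \<forall>l\<in>{1..s}. \<forall>k\<in>{1..s}.
           fst (a i l) = fst (a i k) \<and> fst (b i l) = fst (b i k)) \<and>
        (\<forall>j\<in>{1..s}. \<forall>l\<in>{1..r}. \<forall>k\<in>{1..r}.
           snd (a l j) = snd (a k j) \<and> snd (b l j) = snd (b k j)) \<and>
        (\<forall>i\<in>{1..r - 1}. \<forall>j\<in>{1..s - 1}.
           fst (a (i + 1) j) = fst (b i j) + 1 \<and> snd (a i (j + 1)) = snd (b i j) + 1))"

definition single_interval_cells :: "point set set \<Rightarrow> point set set" where
  "single_interval_cells P = {C \<in> P. card {J \<in> maximal_inner_intervals P. C \<subset> J} = 1}"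

definition subgrid_polyomino :: "point set set \<Rightarrow> point set set \<Rightarrow> bool" where
  "subgrid_polyomino P P' \<longleftrightarrow> polyomino P' \<and> (\<exists>Q \<subseteq> single_interval_cells P. P' = P - Q)"


section \<open>The polyomino ideal\<close>

text \<open>Polynomials in variables indexed by \<open>'v\<close> are finitely supported maps from exponent vectors to
  coefficients; their multiplication is convolution.\<close>

type_synonym ('v, 'k) mpoly = "('v \<Rightarrow>\<^sub>0 nat) \<Rightarrow>\<^sub>0 'k"

definition mvar :: "'v \<Rightarrow> ('v, 'k::comm_ring_1) mpoly" where
  "mvar v = Poly_Mapping.single (Poly_Mapping.single v 1) 1"

definition mvars :: "('v, 'k::zero) mpoly \<Rightarrow> 'v set" where
  "mvars p = (\<Union>t\<in>Poly_Mapping.keys p. Poly_Mapping.keys t)"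

definition poly_ring :: "'v set \<Rightarrow> ('v, 'k::comm_ring_1) mpoly ring" where
  "poly_ring V = \<lparr>carrier = {p. mvars p \<subseteq> V}, mult = (*), one = 1, zero = 0, add = (+)\<rparr>"

definition inner_2_minors :: "point set set \<Rightarrow> (point, 'k::comm_ring_1) mpoly set" where
  "inner_2_minors P =
     {mvar a * mvar b - mvar (fst a, snd b) * mvar (fst b, snd a) |a b. inner_interval P a b}"

definition polyomino_ring :: "point set set \<Rightarrow> (point, 'k::comm_ring_1) mpoly ring" where
  "polyomino_ring P = poly_ring (vertices P)"

definition polyomino_ideal :: "point set set \<Rightarrow> (point, 'k::comm_ring_1) mpoly set" where
  "polyomino_ideal P = genideal (polyomino_ring P) (inner_2_minors P)"


section \<open>Well-formedness\<close>

lemma mvars_add: "mvars (p + q) \<subseteq> mvars p \<union> mvars q"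
  unfolding mvars_def using Poly_Mapping.keys_add[of p q] by blast

lemma mvars_uminus: "mvars (- p) = mvars (p :: ('v, 'k::comm_ring_1) mpoly)"
  by (simp add: mvars_def)

lemma mvars_mult: "mvars (p * q) \<subseteq> mvars p \<union> mvars (q :: ('v, 'k::comm_ring_1) mpoly)"
proof
  fix v assume "v \<in> mvars (p * q)"
  then obtain t where t: "t \<in> Poly_Mapping.keys (p * q)" "v \<in> Poly_Mapping.keys t"
    by (auto simp: mvars_def)
  from t(1) obtain t1 t2 where "t1 \<in> Poly_Mapping.keys p" "t2 \<in> Poly_Mapping.keys q" "t = t1 + t2"
    using Poly_Mapping.keys_mult[of p q] by blast
  with t(2) Poly_Mapping.keys_add[of t1 t2] show "v \<in> mvars p \<union> mvars q"
    unfolding mvars_def by blast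
qed

lemma poly_ring_cring: "cring (poly_ring V :: ('v, 'k::comm_ring_1) mpoly ring)"
proof (rule cringI)
  show "abelian_group (poly_ring V :: ('v, 'k) mpoly ring)"
  proof (rule abelian_groupI)
    fix p :: "('v, 'k) mpoly" assume p: "p \<in> carrier (poly_ring V)"
    show "\<exists>q\<in>carrier (poly_ring V). q \<oplus>\<^bsub>poly_ring V\<^esub> p = \<zero>\<^bsub>poly_ring V\<^esub>"
      using p by (intro bexI[of _ "- p"]) (auto simp: poly_ring_def mvars_uminus)
  next
    fix p q :: "('v, 'k) mpoly"
    assume "p \<in> carrier (poly_ring V)" "q \<in> carrier (poly_ring V)"
    then show "p \<oplus>\<^bsub>poly_ring V\<^esub> q \<in> carrier (poly_ring V)"
      using mvars_add[of p q] by (auto simp: poly_ring_def)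
  qed (simp_all add: poly_ring_def mvars_def add.assoc add.commute)
  show "Group.comm_monoid (poly_ring V :: ('v, 'k) mpoly ring)"
  proof (rule comm_monoidI)
    fix p q :: "('v, 'k) mpoly"
    assume "p \<in> carrier (poly_ring V)" "q \<in> carrier (poly_ring V)"
    then show "p \<otimes>\<^bsub>poly_ring V\<^esub> q \<in> carrier (poly_ring V)"
      using mvars_mult[of p q] by (auto simp: poly_ring_def)
  qed (simp_all add: poly_ring_def mvars_def mult.assoc mult.commute)
qed (simp add: poly_ring_def distrib_right)

lemma inner_interval_corners:
  assumes "inner_interval P a b"
  shows "interval a b \<subseteq> vertices P"
proof
  fix v assume v: "v \<in> interval a b"
  define c where "c = (min (fst v) (fst b - 1), min (snd v) (snd b - 1))"
  have c: "cell c \<subseteq> interval a b" "v \<in> cell c"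
    using v assms by (auto simp: c_def cell_def interval_def inner_interval_def proper_interval_def)
  then have "cell c \<in> P"
    using assms unfolding inner_interval_def cells_def by blast
  with c(2) show "v \<in> vertices P"
    unfolding vertices_def by blast
qed

lemma inner_2_minors_carrier:
  "inner_2_minors P \<subseteq> carrier (polyomino_ring P :: (point, 'k::comm_ring_1) mpoly ring)"
proof
  fix f :: "(point, 'k) mpoly" assume "f \<in> inner_2_minors P"
  then obtain a b where ab: "inner_interval P a b"
    and f: "f = mvar a * mvar b - mvar (fst a, snd b) * mvar (fst b, snd a)"
    by (auto simp: inner_2_minors_def)
  have corners: "{a, b, (fst a, snd b), (fst b, snd a)} \<subseteq> interval a b"
    using ab by (auto simp: inner_interval_def proper_interval_def interval_def mem_Times_iff)
  have var: "mvars (mvar v :: (point, 'k) mpoly) = {v}" for v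
    by (simp add: mvars_def mvar_def)
  have prod: "mvars (mvar v * mvar w :: (point, 'k) mpoly) \<subseteq> {v, w}" for v w
    using mvars_mult[of "mvar v :: (point, 'k) mpoly" "mvar w"] by (auto simp: var)
  have "mvars f \<subseteq> mvars (mvar a * mvar b :: (point, 'k) mpoly) \<union>
      mvars (mvar (fst a, snd b) * mvar (fst b, snd a) :: (point, 'k) mpoly)"
    using mvars_add[of "mvar a * mvar b :: (point, 'k) mpoly"
        "- (mvar (fst a, snd b) * mvar (fst b, snd a))"]
    by (simp add: f mvars_uminus)
  then have "mvars f \<subseteq> {a, b, (fst a, snd b), (fst b, snd a)}"
    using prod[of a b] prod[of "(fst a, snd b)" "(fst b, snd a)"] by blast
  with corners inner_interval_corners[OF ab] show "f \<in> carrier (polyomino_ring P)"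
    by (auto simp: polyomino_ring_def poly_ring_def)
qed

end

theory Submission
  imports Defs "HOL-Library.Countable"
begin

text \<open>The cells of a grid polyomino lie on two families of straight strips of width one: the vertical
  strips at a set \<open>X\<close> of abscissae and the horizontal strips at a set \<open>Y\<close> of ordinates, where
  thinness forbids consecutive elements in \<open>X\<close> and in \<open>Y\<close>. The cell at a crossing of two strips is
  properly contained in two maximal inner intervals (\<open>crossing_not_single\<close>), so that a subgrid
  polyomino still contains all crossings (\<open>subgrid_crossed_strips\<close>); away from them, strips may have
  gaps.

  For such a collection of cells the ideal is shown to be toric. Each vertex \<open>p\<close> is sent to the
  monomial \<open>c h k\<close>, where the variable \<open>c\<close> stands for the maximal vertical line segment in the
  polyomino through \<open>p\<close>, the variable \<open>h\<close> for the maximal horizontal one, and \<open>k\<close> for the crossing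
  cell containing \<open>p\<close> (or, if there is none, for the edge joining the two long sides of the
  strip at \<open>p\<close>). An inner interval lies within one strip, and therefore its inner 2-minor is killed
  (\<open>vertex_weight_swap\<close>).

  Conversely, let two monomials \<open>s\<close> and \<open>t\<close> have the same image, and let the variable of the vertex
  \<open>u\<close> divide \<open>s\<close>. Comparing the variables \<open>k\<close>, some \<open>w\<close> in the support of \<open>t\<close> lies in the
  same crossing cell (or on the same edge) as \<open>u\<close>. If \<open>w\<close> is not in the column of \<open>u\<close>, then comparing the
  variables \<open>c\<close> gives a \<open>z\<close> in the support of \<open>t\<close> on the vertical segment of \<open>u\<close>; since the
  crossings are present, all cells between \<open>w\<close> and \<open>z\<close> are, and the inner 2-minor of that
  interval replaces \<open>w\<close> by the vertex in its row and in the column of \<open>u\<close>. Doing the same with rows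
  produces \<open>u\<close> itself (\<open>exchange\<close>). Cancelling \<open>u\<close> and using induction on the degree shows that
  \<open>s - t\<close> lies in the ideal (\<open>binomial_in_ideal\<close>). Hence the ideal is the kernel of a homomorphism
  into a domain, and so it is prime (\<open>toric_ideal_prime\<close>).\<close>

section \<open>Toric presentations of polynomial ideals\<close>

abbreviation unit_exp :: "'v \<Rightarrow> 'v \<Rightarrow>\<^sub>0 nat" where
  "unit_exp v \<equiv> Poly_Mapping.single v 1"

abbreviation monom :: "('v \<Rightarrow>\<^sub>0 nat) \<Rightarrow> ('v, 'k::comm_ring_1) mpoly" where
  "monom t \<equiv> Poly_Mapping.single t 1"

lemma poly_mapping_nat_induct [case_names zero add_unit]:
  fixes t :: "'v \<Rightarrow>\<^sub>0 nat"
  assumes zero: "P 0" and add_unit: "\<And>t v. P t \<Longrightarrow> P (t + unit_exp v)"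
  shows "P t"
proof (induction t rule: update_induct)
  case const
  show ?case by (fact zero)
next
  case (update f a b)
  have "P (f + Poly_Mapping.single a n)" for n
  proof (induction n)
    case (Suc n)
    then show ?case
      using add_unit[of "f + Poly_Mapping.single a n" a]
      by (simp add: add.assoc flip: single_add)
  qed (use update in simp)
  moreover have "Poly_Mapping.update a b f = f + Poly_Mapping.single a b"
    using update(1)
    by (intro poly_mapping_eqI) (auto simp: lookup_update lookup_add lookup_single when_def in_keys_iff)
  ultimately show ?case by simp
qed

lemma exponent_split:
  fixes t :: "'v \<Rightarrow>\<^sub>0 nat"
  assumes "v \<in> Poly_Mapping.keys t"
  shows "\<exists>s. t = s + unit_exp v"
proof
  show "t = (t - unit_exp v) + unit_exp v"
    using assms
    by (intro poly_mapping_eqI) (auto simp: lookup_add lookup_minus lookup_single when_def in_keys_iff)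
qed

lemma keys_nonempty: "p \<noteq> 0 \<Longrightarrow> \<exists>v. v \<in> Poly_Mapping.keys p"
  by (metis in_keys_iff lookup_zero poly_mapping_eqI)

lemma keys_add_nat:
  fixes s t :: "'v \<Rightarrow>\<^sub>0 nat"
  shows "Poly_Mapping.keys (s + t) = Poly_Mapping.keys s \<union> Poly_Mapping.keys t"
  by (auto simp: in_keys_iff lookup_add)

text \<open>The linear map on finitely supported functions which sends the basis vector at \<open>t\<close> to the one
  at \<open>f t\<close>. If \<open>f\<close> is additive, it is the homomorphism of monoid algebras induced by \<open>f\<close>.\<close>

definition push :: "('a \<Rightarrow> 'b) \<Rightarrow> ('a \<Rightarrow>\<^sub>0 'k::comm_ring_1) \<Rightarrow> ('b \<Rightarrow>\<^sub>0 'k)" where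
  "push f p = (\<Sum>t\<in>Poly_Mapping.keys p. Poly_Mapping.single (f t) (Poly_Mapping.lookup p t))"

lemma push_zero [simp]: "push f 0 = 0"
  by (simp add: push_def)

lemma push_single [simp]: "push f (Poly_Mapping.single t c) = Poly_Mapping.single (f t) c"
  by (simp add: push_def)

lemma push_add: "push f (p + q) = push f p + push f q"
  unfolding push_def by (rule setsum_keys_plus_distrib) (simp_all add: single_add)

lemma push_uminus: "push f (- p) = - push f p"
  using push_add[of f p "- p"] by (simp add: eq_neg_iff_add_eq_0 add.commute)

lemma push_diff: "push f (p - q) = push f p - push f q"
  using push_add[of f p "- q"] by (simp add: push_uminus)

lemma push_sum: "push f (sum g A) = (\<Sum>x\<in>A. push f (g x))"
  by (induction A rule: infinite_finite_induct) (simp_all add: push_add)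

lemma sum_single_lookup:
  "(\<Sum>t\<in>Poly_Mapping.keys p. Poly_Mapping.single t (Poly_Mapping.lookup p t)) = p"
proof (rule poly_mapping_eqI)
  fix s
  have "(\<Sum>t\<in>Poly_Mapping.keys p. Poly_Mapping.lookup p t when t = s) = Poly_Mapping.lookup p s"
    by (simp add: when_def in_keys_iff)
  then show "Poly_Mapping.lookup (\<Sum>t\<in>Poly_Mapping.keys p. Poly_Mapping.single t (Poly_Mapping.lookup p t)) s
      = Poly_Mapping.lookup p s"
    by (simp add: lookup_sum lookup_single)
qed

lemma push_mult:
  fixes p q :: "('a::monoid_add) \<Rightarrow>\<^sub>0 'k::comm_ring_1"
  assumes add: "\<And>s t. f (s + t) = f s + f t"
  shows "push f (p * q) = push f p * push f q"
proof -
  have "p * q = (\<Sum>s\<in>Poly_Mapping.keys p. \<Sum>t\<in>Poly_Mapping.keys q.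
      Poly_Mapping.single (s + t) (Poly_Mapping.lookup p s * Poly_Mapping.lookup q t))"
    unfolding mult_single[symmetric]
    by (simp flip: sum_product add: sum_single_lookup)
  then show ?thesis
    by (simp add: push_sum add push_def[of f p] push_def[of f q] sum_product mult_single)
qed

lemma lookup_push:
  "Poly_Mapping.lookup (push f p) d =
     (\<Sum>t\<in>{t \<in> Poly_Mapping.keys p. f t = d}. Poly_Mapping.lookup p t)"
  by (auto simp: push_def lookup_sum lookup_single when_def intro!: sum.mono_neutral_cong_right split: if_splits)

lemma mvars_monom: "mvars (Poly_Mapping.single t (c::'k::comm_ring_1)) \<subseteq> Poly_Mapping.keys t"
  by (simp add: mvars_def)

lemma poly_ring_simps:
  "p \<in> carrier (poly_ring V) \<longleftrightarrow> mvars p \<subseteq> V"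
  "p \<otimes>\<^bsub>poly_ring V\<^esub> q = p * q" "p \<oplus>\<^bsub>poly_ring V\<^esub> q = p + q"
  "\<one>\<^bsub>poly_ring V\<^esub> = 1" "\<zero>\<^bsub>poly_ring V\<^esub> = 0"
  by (simp_all add: poly_ring_def)

lemma poly_ring_uminus:
  fixes p :: "('v, 'k::comm_ring_1) mpoly"
  assumes "p \<in> carrier (poly_ring V)"
  shows "\<ominus>\<^bsub>poly_ring V\<^esub> p = - p"
proof -
  interpret cring "poly_ring V :: ('v, 'k) mpoly ring" by (rule poly_ring_cring)
  show ?thesis
    using assms by (intro minus_equality) (simp_all add: poly_ring_simps mvars_uminus)
qed

context
  fixes V :: "'v set" and I :: "('v, 'k::comm_ring_1) mpoly set"
  assumes ideal: "ideal I (poly_ring V)"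
begin

lemma poly_ideal_add: "p \<in> I \<Longrightarrow> q \<in> I \<Longrightarrow> p + q \<in> I"
  using additive_subgroup.a_closed[OF ideal.axioms(1)[OF ideal]] by (simp add: poly_ring_simps)

lemma poly_ideal_mult: "p \<in> I \<Longrightarrow> mvars q \<subseteq> V \<Longrightarrow> q * p \<in> I"
  using ideal.I_l_closed[OF ideal] by (simp add: poly_ring_simps)

lemma poly_ideal_zero: "0 \<in> I"
  using additive_subgroup.zero_closed[OF ideal.axioms(1)[OF ideal]] by (simp add: poly_ring_simps)

lemma poly_ideal_uminus: "p \<in> I \<Longrightarrow> - p \<in> I"
  using additive_subgroup.a_inv_closed[OF ideal.axioms(1)[OF ideal]]
    additive_subgroup.a_subset[OF ideal.axioms(1)[OF ideal]]
  by (metis poly_ring_uminus subsetD)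

end

lemma kernel_push_ideal:
  fixes \<Phi> :: "('v \<Rightarrow>\<^sub>0 nat) \<Rightarrow> 'b::monoid_add"
  assumes add: "\<And>s t. \<Phi> (s + t) = \<Phi> s + \<Phi> t"
  shows "ideal {p :: ('v, 'k::comm_ring_1) mpoly. mvars p \<subseteq> V \<and> push \<Phi> p = 0} (poly_ring V)"
proof -
  interpret cring "poly_ring V :: ('v, 'k) mpoly ring" by (rule poly_ring_cring)
  show ?thesis
  proof (rule idealI)
    show "subgroup {p. mvars p \<subseteq> V \<and> push \<Phi> p = 0} (add_monoid (poly_ring V :: ('v, 'k) mpoly ring))"
    proof (rule add.subgroupI)
      show "{p :: ('v, 'k) mpoly. mvars p \<subseteq> V \<and> push \<Phi> p = 0} \<subseteq> carrier (poly_ring V)"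
        by (auto simp: poly_ring_simps)
      show "{p :: ('v, 'k) mpoly. mvars p \<subseteq> V \<and> push \<Phi> p = 0} \<noteq> {}"
        by (auto intro!: exI[of _ 0] simp: mvars_def)
    next
      fix p :: "('v, 'k) mpoly" assume "p \<in> {p. mvars p \<subseteq> V \<and> push \<Phi> p = 0}"
      then show "\<ominus>\<^bsub>poly_ring V\<^esub> p \<in> {p. mvars p \<subseteq> V \<and> push \<Phi> p = 0}"
        by (simp add: poly_ring_uminus poly_ring_simps push_uminus mvars_uminus)
    next
      fix p q :: "('v, 'k) mpoly"
      assume "p \<in> {p. mvars p \<subseteq> V \<and> push \<Phi> p = 0}" "q \<in> {p. mvars p \<subseteq> V \<and> push \<Phi> p = 0}"
      then show "p \<oplus>\<^bsub>poly_ring V\<^esub> q \<in> {p. mvars p \<subseteq> V \<and> push \<Phi> p = 0}"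
        using mvars_add[of p q] by (auto simp: poly_ring_simps push_add)
    qed
  next
    fix p q :: "('v, 'k) mpoly"
    assume *: "p \<in> {p. mvars p \<subseteq> V \<and> push \<Phi> p = 0}" "q \<in> carrier (poly_ring V)"
    show "q \<otimes>\<^bsub>poly_ring V\<^esub> p \<in> {p. mvars p \<subseteq> V \<and> push \<Phi> p = 0}"
      using * mvars_mult[of q p] by (auto simp: poly_ring_simps push_mult[OF add])
    show "p \<otimes>\<^bsub>poly_ring V\<^esub> q \<in> {p. mvars p \<subseteq> V \<and> push \<Phi> p = 0}"
      using * mvars_mult[of p q] by (auto simp: poly_ring_simps push_mult[OF add])
  qed (rule ring_axioms)
qed

text \<open>The kernel of a homomorphism that maps monomials to monomials is spanned by binomials.\<close>

lemma kernel_push_subset: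
  fixes I :: "('v, 'k::comm_ring_1) mpoly set"
  assumes ideal: "ideal I (poly_ring V)"
    and binom: "\<And>s t. \<lbrakk>Poly_Mapping.keys s \<subseteq> V; Poly_Mapping.keys t \<subseteq> V; \<Phi> s = \<Phi> t\<rbrakk>
      \<Longrightarrow> monom s - monom t \<in> I"
  shows "mvars p \<subseteq> V \<Longrightarrow> push \<Phi> p = 0 \<Longrightarrow> p \<in> I"
proof (induction "card (Poly_Mapping.keys p)" arbitrary: p rule: less_induct)
  case less
  show ?case
  proof (cases "p = 0")
    case True
    then show ?thesis by (simp add: poly_ideal_zero[OF ideal])
  next
    case False
    then obtain t where t: "t \<in> Poly_Mapping.keys p"
      using keys_nonempty by blast
    let ?c = "Poly_Mapping.lookup p t"
    \<comment> \<open>The coefficient of \<open>\<Phi> t\<close> in the image vanishes, so the term at \<open>t\<close> cannot be alone in its fibre.\<close>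
    have "\<exists>s\<in>Poly_Mapping.keys p. \<Phi> s = \<Phi> t \<and> s \<noteq> t"
    proof (rule ccontr)
      assume "\<not> ?thesis"
      then have "{s \<in> Poly_Mapping.keys p. \<Phi> s = \<Phi> t} = {t}" using t by auto
      then have "Poly_Mapping.lookup (push \<Phi> p) (\<Phi> t) = ?c" by (simp add: lookup_push)
      then show False using less(3) t by (simp add: in_keys_iff)
    qed
    then obtain s where s: "s \<in> Poly_Mapping.keys p" "\<Phi> s = \<Phi> t" "s \<noteq> t" by blast
    define d where "d = Poly_Mapping.single t ?c - Poly_Mapping.single s ?c"
    have keys: "Poly_Mapping.keys s \<subseteq> V" "Poly_Mapping.keys t \<subseteq> V"
      using s(1) t less(2) by (auto simp: mvars_def)
    have d: "d = Poly_Mapping.single 0 ?c * (monom t - monom s)"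
      by (simp add: d_def right_diff_distrib mult_single)
    have "d \<in> I"
      unfolding d
      by (rule poly_ideal_mult[OF ideal binom]) (use keys s in \<open>auto simp: mvars_def\<close>)
    have sub: "Poly_Mapping.keys (p - d) \<subseteq> Poly_Mapping.keys p - {t}"
      using s t by (auto simp: in_keys_iff d_def lookup_minus lookup_single when_def split: if_splits)
    have "p - d \<in> I"
    proof (rule less(1))
      show "card (Poly_Mapping.keys (p - d)) < card (Poly_Mapping.keys p)"
        using sub t by (intro psubset_card_mono) auto
      show "mvars (p - d) \<subseteq> V"
        using sub less(2) unfolding mvars_def by blast
      show "push \<Phi> (p - d) = 0"
        using less(3) s(2) by (simp add: push_diff d_def)
    qed
    from poly_ideal_add[OF ideal this \<open>d \<in> I\<close>] show ?thesis by simp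
  qed
qed

text \<open>The variables of the target are indexed by \<^typ>\<open>nat\<close>, whose linear order provides a monomial
  order; hence the target is an integral domain.\<close>

theorem toric_ideal_prime:
  fixes I :: "('v, 'k::field) mpoly set" and \<Phi> :: "('v \<Rightarrow>\<^sub>0 nat) \<Rightarrow> nat \<Rightarrow>\<^sub>0 nat"
  assumes ideal: "ideal I (poly_ring V)"
    and add: "\<And>s t. \<Phi> (s + t) = \<Phi> s + \<Phi> t"
    and kernel: "\<And>p. p \<in> I \<Longrightarrow> push \<Phi> p = 0"
    and binom: "\<And>s t. \<lbrakk>Poly_Mapping.keys s \<subseteq> V; Poly_Mapping.keys t \<subseteq> V; \<Phi> s = \<Phi> t\<rbrakk>
      \<Longrightarrow> monom s - monom t \<in> I"
  shows "primeideal I (poly_ring V)"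
proof (rule primeidealI[OF ideal poly_ring_cring])
  have "push \<Phi> (1 :: ('v, 'k) mpoly) \<noteq> 0"
    by (metis lookup_single_eq lookup_zero push_single single_one zero_neq_one)
  then have "(1 :: ('v, 'k) mpoly) \<notin> I" using kernel by blast
  moreover have "(1 :: ('v, 'k) mpoly) \<in> carrier (poly_ring V)"
    by (simp add: poly_ring_simps mvars_def)
  ultimately show "carrier (poly_ring V) \<noteq> I" by blast
next
  fix p q :: "('v, 'k) mpoly"
  assume carr: "p \<in> carrier (poly_ring V)" "q \<in> carrier (poly_ring V)"
    and "p \<otimes>\<^bsub>poly_ring V\<^esub> q \<in> I"
  then have "push \<Phi> p * push \<Phi> q = 0"
    using kernel push_mult[OF add] by (metis poly_ring_simps(2))
  then have "push \<Phi> p = 0 \<or> push \<Phi> q = 0" by simp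
  then show "p \<in> I \<or> q \<in> I"
    using kernel_push_subset[OF ideal binom] carr by (auto simp: poly_ring_simps)
qed

text \<open>The monoid homomorphism on exponent vectors with value \<open>\<phi> v\<close> at the unit vector of \<open>v\<close>.\<close>

definition extend_exp :: "('v \<Rightarrow> ('l \<Rightarrow>\<^sub>0 nat)) \<Rightarrow> ('v \<Rightarrow>\<^sub>0 nat) \<Rightarrow> ('l \<Rightarrow>\<^sub>0 nat)" where
  "extend_exp \<phi> t = (\<Sum>v\<in>Poly_Mapping.keys t. Poly_Mapping.map ((*) (Poly_Mapping.lookup t v)) (\<phi> v))"

lemma lookup_map_times:
  "Poly_Mapping.lookup (Poly_Mapping.map ((*) c) p) l = c * Poly_Mapping.lookup p (l :: 'l)" for c :: nat
  by (simp add: map.rep_eq when_def)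

lemma extend_exp_add: "extend_exp \<phi> (s + t) = extend_exp \<phi> s + extend_exp \<phi> t"
  unfolding extend_exp_def
  by (rule setsum_keys_plus_distrib; rule poly_mapping_eqI)
    (simp_all only: lookup_add lookup_map_times lookup_zero, simp_all only: distrib_right mult_zero_left)

lemma extend_exp_unit [simp]: "extend_exp \<phi> (unit_exp v) = \<phi> v"
  by (auto intro!: poly_mapping_eqI simp: extend_exp_def lookup_map_times)

lemma lookup_extend_exp_neq_0_iff:
  "Poly_Mapping.lookup (extend_exp \<phi> t) l \<noteq> 0 \<longleftrightarrow>
     (\<exists>v\<in>Poly_Mapping.keys t. Poly_Mapping.lookup (\<phi> v) l \<noteq> 0)"
  by (auto simp: extend_exp_def lookup_sum lookup_map_times in_keys_iff)


section \<open>Strips with all crossings\<close>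

text \<open>\<open>C x y\<close> says that the cell with lower left corner \<open>(x, y)\<close> is present. All cells lie on the
  vertical strips at \<open>X\<close> or the horizontal strips at \<open>Y\<close>, and all crossings of the strips are
  present; strips of the same family share no vertices. A strip may have gaps away from the
  crossings.\<close>

definition crossed_strips :: "nat set \<Rightarrow> nat set \<Rightarrow> (nat \<Rightarrow> nat \<Rightarrow> bool) \<Rightarrow> bool" where
  "crossed_strips X Y C \<longleftrightarrow>
     (\<forall>x y. C x y \<longrightarrow> x \<in> X \<or> y \<in> Y) \<and> (\<forall>x\<in>X. \<forall>y\<in>Y. C x y) \<and>
     (\<forall>x\<in>X. Suc x \<notin> X) \<and> (\<forall>y\<in>Y. Suc y \<notin> Y)"

lemma crossed_strips_transpose:
  "crossed_strips X Y C \<Longrightarrow> crossed_strips Y X (\<lambda>y x. C x y)"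
  by (auto simp: crossed_strips_def)

text \<open>All cells of the rectangle with opposite corners \<open>p\<close> and \<open>q\<close> are present. The corners may be
  given in any order, diagonal or anti-diagonal.\<close>

definition block :: "(nat \<Rightarrow> nat \<Rightarrow> bool) \<Rightarrow> point \<Rightarrow> point \<Rightarrow> bool" where
  "block C p q \<longleftrightarrow>
     (\<forall>x y. min (fst p) (fst q) \<le> x \<and> x < max (fst p) (fst q) \<and>
            min (snd p) (snd q) \<le> y \<and> y < max (snd p) (snd q) \<longrightarrow> C x y)"

lemma block_transpose: "block (\<lambda>y x. C x y) (prod.swap p) (prod.swap q) \<longleftrightarrow> block C p q"
  by (auto simp: block_def)

text \<open>The segment from \<open>(u, t)\<close> to \<open>(u, Suc t)\<close> is an edge of a cell that is present.\<close>

definition line_edge :: "(nat \<Rightarrow> nat \<Rightarrow> bool) \<Rightarrow> nat \<Rightarrow> nat \<Rightarrow> bool" where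
  "line_edge C u t \<longleftrightarrow> C u t \<or> (\<exists>x. u = Suc x \<and> C x t)"

text \<open>The ordinate of the lower end of the maximal vertical line segment through \<open>(u, v)\<close> that
  consists of edges of cells. It serves as a label of that segment.\<close>

definition line_start :: "(nat \<Rightarrow> nat \<Rightarrow> bool) \<Rightarrow> nat \<Rightarrow> nat \<Rightarrow> nat" where
  "line_start C u v = (LEAST w. \<forall>t. w \<le> t \<and> t < v \<longrightarrow> line_edge C u t)"

lemma line_start_eq_aux:
  assumes "v \<le> v'"
  shows "line_start C u v = line_start C u v' \<longleftrightarrow> (\<forall>t. v \<le> t \<and> t < v' \<longrightarrow> line_edge C u t)"
proof
  assume eq: "line_start C u v = line_start C u v'"
  have "line_start C u v \<le> v"
    unfolding line_start_def by (rule Least_le) auto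
  moreover have "\<forall>t. line_start C u v' \<le> t \<and> t < v' \<longrightarrow> line_edge C u t"
    unfolding line_start_def by (rule LeastI[of _ v']) auto
  ultimately show "\<forall>t. v \<le> t \<and> t < v' \<longrightarrow> line_edge C u t"
    using eq by auto
next
  assume *: "\<forall>t. v \<le> t \<and> t < v' \<longrightarrow> line_edge C u t"
  have "(\<forall>t. w \<le> t \<and> t < v \<longrightarrow> line_edge C u t) \<longleftrightarrow> (\<forall>t. w \<le> t \<and> t < v' \<longrightarrow> line_edge C u t)" for w
    using * assms by (meson le_less_trans less_le_trans linorder_not_le)
  then show "line_start C u v = line_start C u v'"
    by (simp add: line_start_def)
qed

lemma line_start_eq_iff:
  "line_start C u v = line_start C u v' \<longleftrightarrow>
     (\<forall>t. min v v' \<le> t \<and> t < max v v' \<longrightarrow> line_edge C u t)"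
proof (cases "v \<le> v'")
  case True
  then show ?thesis using line_start_eq_aux[OF True] by (simp add: min_def max_def)
next
  case False
  then have "v' \<le> v" by simp
  from line_start_eq_aux[OF this, of C u] False show ?thesis
    by (auto simp: min_def max_def)
qed

text \<open>Identifies the two long sides, at \<open>x\<close> and \<open>Suc x\<close>, of each strip \<open>x \<in> X\<close>.\<close>

definition merge :: "nat set \<Rightarrow> nat \<Rightarrow> nat" where
  "merge X u = (if \<exists>x\<in>X. u = Suc x then u - 1 else u)"

lemma merge_eqD:
  assumes "merge X u = merge X u'" "u \<noteq> u'"
  shows "\<exists>x\<in>X. min u u' = x \<and> max u u' = Suc x"
  using assms by (auto simp: merge_def min_def max_def split: if_splits)

lemma merge_strip:
  assumes "\<forall>x\<in>X. Suc x \<notin> X" "min u u' \<in> X" "max u u' = Suc (min u u')"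
  shows "merge X u = merge X u'"
  using assms by (auto simp: merge_def min_def max_def split: if_splits)

text \<open>The geometric heart of the exchange argument. Let \<open>u\<close> and \<open>w\<close> lie on different sides of a
  vertical strip, at the same height or at the two heights of one crossing cell, and let \<open>z\<close> lie on
  the vertical segment of \<open>u\<close>. Then the strip has no gap between \<open>w\<close> and \<open>z\<close>.\<close>

lemma block_of_same_line:
  assumes cs: "crossed_strips X Y C"
    and X: "merge X (fst w) = merge X (fst u)" "fst w \<noteq> fst u"
    and Y: "merge Y (snd w) = merge Y (snd u)"
    and z: "fst z = fst u" "line_start C (fst u) (snd z) = line_start C (fst u) (snd u)"
  shows "block C w z"
proof -
  obtain x where x: "x \<in> X" "min (fst w) (fst u) = x" "max (fst w) (fst u) = Suc x"
    using merge_eqD[OF X] by blast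
  \<comment> \<open>An edge on a side of the strip which borders a cell outside of it lies on a horizontal
    strip, so that the cell of the vertical strip is a crossing.\<close>
  have edge: "C x t" if "line_edge C (fst u) t" for t
  proof -
    have "fst u = x \<or> fst u = Suc x" using x by linarith
    then show ?thesis
      using that x(1) cs unfolding line_edge_def crossed_strips_def by (metis nat.inject)
  qed
  have "C x t" if t: "min (snd w) (snd z) \<le> t" "t < max (snd w) (snd z)" for t
  proof (cases "min (snd z) (snd u) \<le> t \<and> t < max (snd z) (snd u)")
    case True
    then show ?thesis using z(2) edge unfolding line_start_eq_iff by blast
  next
    case False
    then have neq: "snd w \<noteq> snd u" and t': "min (snd w) (snd u) \<le> t" "t < max (snd w) (snd u)"
      using t by linarith+
    then have "t \<in> Y" using merge_eqD[OF Y neq] by (metis le_antisym less_Suc_eq_le)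
    then show ?thesis using x(1) cs by (auto simp: crossed_strips_def)
  qed
  moreover have "min (fst w) (fst z) = x" "max (fst w) (fst z) = Suc x"
    using x z(1) by simp_all
  ultimately show ?thesis unfolding block_def by (metis le_antisym less_Suc_eq_le)
qed

text \<open>Labels of the maximal vertical and horizontal line segments through a vertex, and of the
  crossing cell at a vertex. For a vertex outside of the crossing cells the last label is that of the
  two vertices at its position along its strip.\<close>

definition column_class :: "(nat \<Rightarrow> nat \<Rightarrow> bool) \<Rightarrow> point \<Rightarrow> point" where
  "column_class C p = (fst p, line_start C (fst p) (snd p))"

definition row_class :: "(nat \<Rightarrow> nat \<Rightarrow> bool) \<Rightarrow> point \<Rightarrow> point" where
  "row_class C p = (line_start (\<lambda>y x. C x y) (snd p) (fst p), snd p)"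

definition merge_class :: "nat set \<Rightarrow> nat set \<Rightarrow> point \<Rightarrow> point" where
  "merge_class X Y p = (merge X (fst p), merge Y (snd p))"

text \<open>The exponent vector of the monomial attached to a vertex: the product of the variables of its
  three labels, which are kept apart by a tag.\<close>

definition vertex_weight :: "nat set \<Rightarrow> nat set \<Rightarrow> (nat \<Rightarrow> nat \<Rightarrow> bool) \<Rightarrow> point \<Rightarrow> nat \<Rightarrow>\<^sub>0 nat" where
  "vertex_weight X Y C p = unit_exp (to_nat (0 :: nat, column_class C p)) +
     unit_exp (to_nat (1 :: nat, row_class C p)) + unit_exp (to_nat (2 :: nat, merge_class X Y p))"

lemma vertex_weight_lookup:
  "Poly_Mapping.lookup (vertex_weight X Y C p) (to_nat (0 :: nat, l)) \<noteq> 0 \<longleftrightarrow> column_class C p = l"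
  "Poly_Mapping.lookup (vertex_weight X Y C p) (to_nat (1 :: nat, l)) \<noteq> 0 \<longleftrightarrow> row_class C p = l"
  "Poly_Mapping.lookup (vertex_weight X Y C p) (to_nat (2 :: nat, l)) \<noteq> 0 \<longleftrightarrow> merge_class X Y p = l"
  by (simp_all add: vertex_weight_def lookup_add lookup_single when_def)

lemma column_class_block:
  assumes "block C p q" "fst p \<noteq> fst q"
  shows "column_class C p = column_class C (fst p, snd q)"
proof -
  have "line_edge C (fst p) t" if "min (snd p) (snd q) \<le> t" "t < max (snd p) (snd q)" for t
  proof (cases "fst p < fst q")
    case True
    then show ?thesis using assms(1) that by (auto simp: block_def line_edge_def)
  next
    case False
    then obtain x where "fst p = Suc x" "fst q \<le> x"
      using assms(2) by (cases "fst p") auto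
    then show ?thesis using assms(1) that by (auto simp: block_def line_edge_def)
  qed
  then show ?thesis by (simp add: column_class_def line_start_eq_iff)
qed

lemma row_class_column_class:
  "row_class C p = prod.swap (column_class (\<lambda>y x. C x y) (prod.swap p))"
  by (simp add: row_class_def column_class_def)

lemma row_class_block:
  assumes "block C p q" "snd p \<noteq> snd q"
  shows "row_class C p = row_class C (fst q, snd p)"
  using column_class_block[of "\<lambda>y x. C x y" "prod.swap p" "prod.swap q"] assms
  by (simp add: row_class_column_class block_transpose)

lemma block_commute: "block C p q \<longleftrightarrow> block C q p"
  by (simp add: block_def min.commute max.commute)

text \<open>A rectangle of cells has width or height one, and lies within a single strip, whose long sides
  are identified.\<close>

lemma block_within_strip:
  assumes cs: "crossed_strips X Y C" and "block C p q" "fst p \<noteq> fst q" "snd p \<noteq> snd q"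
  shows "merge X (fst p) = merge X (fst q) \<or> merge Y (snd p) = merge Y (snd q)"
proof -
  define x y where "x = min (fst p) (fst q)" and "y = min (snd p) (snd q)"
  define x' y' where "x' = max (fst p) (fst q)" and "y' = max (snd p) (snd q)"
  have lt: "x < x'" "y < y'" using assms(3,4) by (auto simp: x_def x'_def y_def y'_def)
  have C: "C i j" if "x \<le> i" "i < x'" "y \<le> j" "j < y'" for i j
    using assms(2) that unfolding block_def x_def x'_def y_def y'_def by blast
  have "(x \<in> X \<and> x' = Suc x) \<or> (y \<in> Y \<and> y' = Suc y)"
  proof -
    have 1: "C x y" using C lt by simp
    have 2: "C (Suc x) y" if "x' \<noteq> Suc x" using C lt that by simp
    have 3: "C x (Suc y)" if "y' \<noteq> Suc y" using C lt that by simp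
    have 4: "C (Suc x) (Suc y)" if "y' \<noteq> Suc y" "x' \<noteq> Suc x" using C lt that by simp
    show ?thesis using 1 2 3 4 cs unfolding crossed_strips_def by metis
  qed
  then show ?thesis
    using merge_strip[of X "fst p" "fst q"] merge_strip[of Y "snd p" "snd q"] cs
    by (auto simp: crossed_strips_def x_def x'_def y_def y'_def)
qed

lemma vertex_weight_swap:
  assumes cs: "crossed_strips X Y C" and blk: "block C p q" and neq: "fst p \<noteq> fst q" "snd p \<noteq> snd q"
  shows "vertex_weight X Y C p + vertex_weight X Y C q =
    vertex_weight X Y C (fst p, snd q) + vertex_weight X Y C (fst q, snd p)"
proof -
  have blk': "block C q p" using blk by (simp add: block_commute)
  have 1: "column_class C p = column_class C (fst p, snd q)" "column_class C q = column_class C (fst q, snd p)"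
    using column_class_block[OF blk] column_class_block[OF blk'] neq by auto
  have 2: "row_class C p = row_class C (fst q, snd p)" "row_class C q = row_class C (fst p, snd q)"
    using row_class_block[OF blk] row_class_block[OF blk'] neq by auto
  have 3: "merge_class X Y p = merge_class X Y (fst q, snd p) \<and> merge_class X Y q = merge_class X Y (fst p, snd q) \<or>
     merge_class X Y p = merge_class X Y (fst p, snd q) \<and> merge_class X Y q = merge_class X Y (fst q, snd p)"
    using block_within_strip[OF cs blk neq] by (auto simp: merge_class_def)
  then show ?thesis unfolding vertex_weight_def 1 2
    by (elim disjE conjE) (simp_all add: ac_simps)
qed

section \<open>The ideal of a polyomino made of crossed strips\<close>

lemma cell_subset_interval:
  "cell (x, y) \<subseteq> interval a b \<longleftrightarrow> fst a \<le> x \<and> x < fst b \<and> snd a \<le> y \<and> y < snd b"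
  by (auto simp: cell_def interval_def times_subset_iff)

lemma inner_interval_block:
  "inner_interval P a b \<longleftrightarrow> proper_interval a b \<and> block (\<lambda>x y. cell (x, y) \<in> P) a b"
proof (cases "proper_interval a b")
  case True
  then have "min (fst a) (fst b) = fst a" "max (fst a) (fst b) = fst b"
    "min (snd a) (snd b) = snd a" "max (snd a) (snd b) = snd b"
    by (auto simp: proper_interval_def)
  then show ?thesis
    using True by (auto simp: inner_interval_def block_def cells_def cell_subset_interval)
qed (simp add: inner_interval_def)

lemma mvar_mult: "mvar v * mvar w = (monom (unit_exp v + unit_exp w) :: ('v, 'k::comm_ring_1) mpoly)"
  by (simp add: mvar_def mult_single)

lemma polyomino_ideal_is_ideal:
  "ideal (polyomino_ideal P :: (point, 'k::comm_ring_1) mpoly set) (polyomino_ring P)"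
proof -
  interpret cring "polyomino_ring P :: (point, 'k) mpoly ring"
    unfolding polyomino_ring_def by (rule poly_ring_cring)
  show ?thesis
    unfolding polyomino_ideal_def by (rule genideal_ideal[OF inner_2_minors_carrier])
qed

lemma inner_2_minors_subset: "inner_2_minors P \<subseteq> (polyomino_ideal P :: (point, 'k::comm_ring_1) mpoly set)"
proof -
  interpret cring "polyomino_ring P :: (point, 'k) mpoly ring"
    unfolding polyomino_ring_def by (rule poly_ring_cring)
  show ?thesis
    unfolding polyomino_ideal_def by (rule genideal_self[OF inner_2_minors_carrier])
qed

lemma block_binomial:
  assumes "block (\<lambda>x y. cell (x, y) \<in> P) p q" "fst p \<noteq> fst q" "snd p \<noteq> snd q"
  shows "monom (unit_exp p + unit_exp q) - monom (unit_exp (fst p, snd q) + unit_exp (fst q, snd p))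
      \<in> (polyomino_ideal P :: (point, 'k::comm_ring_1) mpoly set)"
    and "(fst p, snd q) \<in> vertices P" and "(fst q, snd p) \<in> vertices P"
proof -
  define a b :: point where "a = (min (fst p) (fst q), min (snd p) (snd q))"
    and "b = (max (fst p) (fst q), max (snd p) (snd q))"
  have inner: "inner_interval P a b"
    using assms by (auto simp: inner_interval_block proper_interval_def block_def a_def b_def)
  show "(fst p, snd q) \<in> vertices P" "(fst q, snd p) \<in> vertices P"
    using inner_interval_corners[OF inner] by (auto simp: interval_def a_def b_def)
  let ?f = "monom (unit_exp p + unit_exp q) :: (point, 'k) mpoly"
  let ?g = "monom (unit_exp (fst p, snd q) + unit_exp (fst q, snd p)) :: (point, 'k) mpoly"
  have "mvar a * mvar b - mvar (fst a, snd b) * mvar (fst b, snd a)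
      \<in> (polyomino_ideal P :: (point, 'k) mpoly set)"
    using inner inner_2_minors_subset[of P] unfolding inner_2_minors_def by blast
  then have "monom (unit_exp a + unit_exp b) - monom (unit_exp (fst a, snd b) + unit_exp (fst b, snd a))
      \<in> (polyomino_ideal P :: (point, 'k) mpoly set)" (is "?d \<in> _")
    unfolding mvar_mult .
  moreover have "?d = ?f - ?g \<or> ?d = - (?f - ?g)"
  proof -
    have "unit_exp a + unit_exp b = unit_exp p + unit_exp q \<and>
          unit_exp (fst a, snd b) + unit_exp (fst b, snd a) = unit_exp (fst p, snd q) + unit_exp (fst q, snd p) \<or>
        unit_exp a + unit_exp b = unit_exp (fst p, snd q) + unit_exp (fst q, snd p) \<and>
          unit_exp (fst a, snd b) + unit_exp (fst b, snd a) = unit_exp p + unit_exp q"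
      by (cases "fst p \<le> fst q"; cases "snd p \<le> snd q")
        (simp_all add: a_def b_def min_def max_def add.commute)
    then show ?thesis by (elim disjE conjE) (simp_all only: minus_diff_eq simp_thms)
  qed
  ultimately have "?f - ?g \<in> polyomino_ideal P \<or> - (?f - ?g) \<in> polyomino_ideal P"
    by (elim disjE) (simp_all only: simp_thms)
  then show "?f - ?g \<in> polyomino_ideal P"
    using poly_ideal_uminus[OF polyomino_ideal_is_ideal[unfolded polyomino_ring_def], of "- (?f - ?g)" P]
    unfolding minus_minus by blast
qed

context
  fixes P :: "point set set" and X Y :: "nat set" and C :: "nat \<Rightarrow> nat \<Rightarrow> bool"
    and I :: "(point, 'k::field) mpoly set" and \<Phi> :: "(point \<Rightarrow>\<^sub>0 nat) \<Rightarrow> (nat \<Rightarrow>\<^sub>0 nat)"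
  defines "C \<equiv> \<lambda>x y. cell (x, y) \<in> P" and "I \<equiv> polyomino_ideal P"
    and "\<Phi> \<equiv> extend_exp (vertex_weight X Y C)"
  assumes cs: "crossed_strips X Y C"
begin

lemma \<Phi>_add: "\<Phi> (s + t) = \<Phi> s + \<Phi> t"
  by (simp add: \<Phi>_def extend_exp_add)

lemma \<Phi>_unit: "\<Phi> (unit_exp v) = vertex_weight X Y C v"
  unfolding \<Phi>_def by (rule extend_exp_unit)

lemma I_ideal: "ideal I (poly_ring (vertices P))"
  using polyomino_ideal_is_ideal by (simp add: I_def polyomino_ring_def)

lemma I_kernel:
  assumes "p \<in> I"
  shows "push \<Phi> p = 0"
proof -
  let ?K = "{p :: (point, 'k) mpoly. mvars p \<subseteq> vertices P \<and> push \<Phi> p = 0}"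
  interpret cring "poly_ring (vertices P) :: (point, 'k) mpoly ring" by (rule poly_ring_cring)
  have "push \<Phi> f = 0" if mem: "f \<in> (inner_2_minors P :: (point, 'k) mpoly set)" for f
  proof -
    obtain a b where ab: "inner_interval P a b"
      and f: "f = mvar a * mvar b - mvar (fst a, snd b) * mvar (fst b, snd a)"
      using mem unfolding inner_2_minors_def by blast
    then have "block C a b" "fst a \<noteq> fst b" "snd a \<noteq> snd b"
      by (auto simp: inner_interval_block C_def proper_interval_def)
    from vertex_weight_swap[OF cs this] show ?thesis
      unfolding f mvar_mult by (simp add: push_diff \<Phi>_add \<Phi>_unit flip: One_nat_def)
  qed
  then have "inner_2_minors P \<subseteq> ?K"
    using inner_2_minors_carrier[of P] unfolding polyomino_ring_def poly_ring_simps[abs_def]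
    by (auto simp: poly_ring_def)
  then have "I \<subseteq> ?K"
    unfolding I_def polyomino_ideal_def polyomino_ring_def
    by (intro genideal_minimal kernel_push_ideal) (auto simp: \<Phi>_add)
  then show ?thesis using assms by blast
qed

text \<open>The monomial of \<open>t\<close> is a monomial in the vertices which is congruent to that of \<open>s\<close> modulo the
  ideal. That the images under \<open>\<Phi>\<close> agree is a consequence which is carried along.\<close>

definition equiv_exp :: "(point \<Rightarrow>\<^sub>0 nat) \<Rightarrow> (point \<Rightarrow>\<^sub>0 nat) \<Rightarrow> bool" where
  "equiv_exp s t \<longleftrightarrow> Poly_Mapping.keys t \<subseteq> vertices P \<and> \<Phi> s = \<Phi> t \<and> monom s - monom t \<in> I"

lemma equiv_exp_refl: "Poly_Mapping.keys t \<subseteq> vertices P \<Longrightarrow> equiv_exp t t"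
  by (simp add: equiv_exp_def poly_ideal_zero[OF I_ideal])

lemma equiv_exp_trans: "equiv_exp r s \<Longrightarrow> equiv_exp s t \<Longrightarrow> equiv_exp r t"
  using poly_ideal_add[OF I_ideal, of "monom r - monom s" "monom s - monom t"]
  by (simp add: equiv_exp_def)

lemma swap_move:
  assumes t: "Poly_Mapping.keys t \<subseteq> vertices P" "p \<in> Poly_Mapping.keys t" "q \<in> Poly_Mapping.keys t"
    and pq: "block C p q" "fst p \<noteq> fst q" "snd p \<noteq> snd q"
  shows "\<exists>t'. equiv_exp t t' \<and> (fst p, snd q) \<in> Poly_Mapping.keys t' \<and> (fst q, snd p) \<in> Poly_Mapping.keys t'"
proof -
  obtain t1 where t1: "t = t1 + unit_exp p" using exponent_split[OF t(2)] by blast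
  have "p \<noteq> q" using pq(2) by blast
  then have "q \<in> Poly_Mapping.keys t1" using t(3) unfolding t1 keys_add_nat by simp
  from exponent_split[OF this] obtain t0 where "t1 = t0 + unit_exp q" by blast
  with t1 have t0: "t = t0 + (unit_exp p + unit_exp q)" by (simp add: ac_simps)
  define t' where "t' = t0 + (unit_exp (fst p, snd q) + unit_exp (fst q, snd p))"
  note bin = block_binomial(1)[OF pq[unfolded C_def], where 'k = 'k, folded I_def]
    block_binomial(2,3)[OF pq[unfolded C_def]]
  have "monom t - monom t' = (monom t0 :: (point, 'k) mpoly) *
      (monom (unit_exp p + unit_exp q) - monom (unit_exp (fst p, snd q) + unit_exp (fst q, snd p)))"
    by (simp add: t0 t'_def right_diff_distrib mult_single)
  also have "\<dots> \<in> I"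
    using t(1) order_trans[OF mvars_monom[of t0 "1::'k"], of "vertices P"]
    by (intro poly_ideal_mult[OF I_ideal bin(1)]) (simp only: t0 keys_add_nat Un_subset_iff)
  finally have "monom t - monom t' \<in> I" .
  moreover have "\<Phi> t = \<Phi> t'"
    unfolding t0 t'_def \<Phi>_add \<Phi>_unit vertex_weight_swap[OF cs pq] ..
  moreover have "Poly_Mapping.keys t' \<subseteq> vertices P"
    using t(1) bin(2,3) by (simp add: t0 t'_def keys_add_nat)
  ultimately have "equiv_exp t t'" unfolding equiv_exp_def by blast
  moreover have "(fst p, snd q) \<in> Poly_Mapping.keys t'" "(fst q, snd p) \<in> Poly_Mapping.keys t'"
    by (simp_all add: t'_def keys_add_nat)
  ultimately show ?thesis by blast
qed

lemma exchange:
  assumes t: "Poly_Mapping.keys t \<subseteq> vertices P" and eq: "\<Phi> t = \<Phi> s" and u: "u \<in> Poly_Mapping.keys s"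
  shows "\<exists>t'. equiv_exp t t' \<and> u \<in> Poly_Mapping.keys t'"
proof -
  \<comment> \<open>Equal images have equal sets of labels in their supports.\<close>
  have support: "(\<exists>z\<in>Poly_Mapping.keys t'. column_class C z = column_class C u) \<and>
      (\<exists>z\<in>Poly_Mapping.keys t'. row_class C z = row_class C u) \<and>
      (\<exists>z\<in>Poly_Mapping.keys t'. merge_class X Y z = merge_class X Y u)" if \<Phi>_eq: "\<Phi> t' = \<Phi> s" for t'
  proof -
    have *: "\<exists>z\<in>Poly_Mapping.keys t'. Poly_Mapping.lookup (vertex_weight X Y C z) l \<noteq> 0"
      if l: "Poly_Mapping.lookup (vertex_weight X Y C u) l \<noteq> 0" for l
    proof -
      have "Poly_Mapping.lookup (\<Phi> t') l \<noteq> 0"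
        unfolding \<Phi>_eq unfolding \<Phi>_def lookup_extend_exp_neq_0_iff by (intro bexI) (fact l, fact u)
      then show ?thesis
        unfolding \<Phi>_def lookup_extend_exp_neq_0_iff .
    qed
    show ?thesis
      using *[of "to_nat (0 :: nat, column_class C u)"] *[of "to_nat (1 :: nat, row_class C u)"]
        *[of "to_nat (2 :: nat, merge_class X Y u)"]
      unfolding vertex_weight_lookup by simp
  qed
  obtain w where w: "w \<in> Poly_Mapping.keys t" "merge_class X Y w = merge_class X Y u"
    using support[OF eq] by blast
  have "\<exists>t1. equiv_exp t t1 \<and> (fst u, snd w) \<in> Poly_Mapping.keys t1"
  proof (cases "fst w = fst u")
    case True
    then have "w = (fst u, snd w)" by (simp add: prod_eq_iff)
    then show ?thesis using w(1) equiv_exp_refl[OF t] by metis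
  next
    case False
    obtain z where z: "z \<in> Poly_Mapping.keys t" "column_class C z = column_class C u"
      using support[OF eq] by blast
    have fst_z: "fst z = fst u"
      using z(2) by (simp add: column_class_def)
    have start: "line_start C (fst z) (snd z) = line_start C (fst u) (snd u)"
      using z(2) unfolding column_class_def prod.inject by blast
    have blk: "block C w z"
      by (rule block_of_same_line[OF cs, where u = u])
        (use w(2) start[unfolded fst_z] fst_z False in \<open>simp_all add: merge_class_def\<close>)
    show ?thesis
    proof (cases "snd z = snd w")
      case True
      then have "z = (fst u, snd w)" using fst_z by (simp add: prod_eq_iff)
      then show ?thesis using z(1) equiv_exp_refl[OF t] by blast
    next
      case False
      have "\<exists>t'. equiv_exp t t' \<and> (fst w, snd z) \<in> Poly_Mapping.keys t' \<and>
          (fst z, snd w) \<in> Poly_Mapping.keys t'"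
        by (rule swap_move[OF t w(1) z(1) blk]) (use False \<open>fst w \<noteq> fst u\<close> fst_z in simp_all)
      then show ?thesis unfolding fst_z by blast
    qed
  qed
  then obtain t1 where t1: "equiv_exp t t1" "(fst u, snd w) \<in> Poly_Mapping.keys t1" by blast
  then have t1': "Poly_Mapping.keys t1 \<subseteq> vertices P" "\<Phi> t1 = \<Phi> s" using eq by (auto simp: equiv_exp_def)
  have "\<exists>t2. equiv_exp t1 t2 \<and> u \<in> Poly_Mapping.keys t2"
  proof (cases "snd w = snd u")
    case True
    then have "(fst u, snd w) = u" by (simp add: prod_eq_iff)
    then show ?thesis using t1(2) equiv_exp_refl[OF t1'(1)] by metis
  next
    case False
    obtain z where z: "z \<in> Poly_Mapping.keys t1" "row_class C z = row_class C u"
      using support[OF t1'(2)] by blast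
    have snd_z: "snd z = snd u"
      using z(2) by (simp add: row_class_def)
    have start: "line_start (\<lambda>y x. C x y) (snd z) (fst z) = line_start (\<lambda>y x. C x y) (snd u) (fst u)"
      using z(2) unfolding row_class_def prod.inject by blast
    have "block (\<lambda>y x. C x y) (prod.swap (fst u, snd w)) (prod.swap z)"
      by (rule block_of_same_line[OF crossed_strips_transpose[OF cs], where u = "prod.swap u"])
        (use w(2) start[unfolded snd_z] snd_z False in \<open>simp_all add: merge_class_def\<close>)
    then have blk: "block C (fst u, snd w) z" by (simp only: block_transpose)
    have u_eq: "(fst u, snd z) = u" using snd_z by simp
    show ?thesis
    proof (cases "fst z = fst u")
      case True
      then have "z = u" using snd_z by (simp add: prod_eq_iff)
      then show ?thesis using z(1) equiv_exp_refl[OF t1'(1)] by blast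
    next
      case False
      have "\<exists>t'. equiv_exp t1 t' \<and> (fst (fst u, snd w), snd z) \<in> Poly_Mapping.keys t' \<and>
          (fst z, snd (fst u, snd w)) \<in> Poly_Mapping.keys t'"
        by (rule swap_move[OF t1'(1) t1(2) z(1) blk]) (use False \<open>snd w \<noteq> snd u\<close> snd_z in simp_all)
      then have "\<exists>t'. equiv_exp t1 t' \<and> (fst u, snd z) \<in> Poly_Mapping.keys t'"
        unfolding fst_conv by blast
      then show ?thesis by (simp only: u_eq)
    qed
  qed
  then show ?thesis using equiv_exp_trans[OF t1(1)] by blast
qed

lemma binomial_in_ideal:
  assumes "Poly_Mapping.keys s \<subseteq> vertices P" "Poly_Mapping.keys t \<subseteq> vertices P" "\<Phi> s = \<Phi> t"
  shows "monom s - monom t \<in> I"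
  using assms
proof (induction s arbitrary: t rule: poly_mapping_nat_induct)
  case zero
  have "t = 0"
  proof (rule ccontr)
    assume "t \<noteq> 0"
    then obtain v where v: "v \<in> Poly_Mapping.keys t"
      using keys_nonempty by blast
    have "Poly_Mapping.lookup (\<Phi> t) (to_nat (0 :: nat, column_class C v)) \<noteq> 0"
      unfolding \<Phi>_def lookup_extend_exp_neq_0_iff
      by (rule bexI[OF _ v]) (simp only: vertex_weight_lookup)
    moreover have "\<Phi> t = 0" unfolding zero(3)[symmetric] by (simp add: \<Phi>_def extend_exp_def)
    ultimately show False by (simp only: lookup_zero)
  qed
  then show ?case by (simp add: poly_ideal_zero[OF I_ideal])
next
  case (add_unit s u)
  obtain t' where t': "equiv_exp t t'" "u \<in> Poly_Mapping.keys t'"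
    using exchange[OF add_unit(3), of "s + unit_exp u" u] add_unit(4) by (auto simp: keys_add_nat)
  obtain t0 where t0: "t' = t0 + unit_exp u" using exponent_split[OF t'(2)] by blast
  have keys: "Poly_Mapping.keys t' \<subseteq> vertices P" and \<Phi>: "\<Phi> t = \<Phi> t'" and diff: "monom t - monom t' \<in> I"
    using t'(1) by (simp_all add: equiv_exp_def)
  have "monom s - monom t0 \<in> I"
    using add_unit(2,4) keys \<Phi> by (intro add_unit(1)) (auto simp: t0 keys_add_nat \<Phi>_add)
  then have "monom (unit_exp u) * (monom s - monom t0) \<in> I"
    using add_unit(2) order_trans[OF mvars_monom[of "unit_exp u" "1::'k"], of "vertices P"]
    by (intro poly_ideal_mult[OF I_ideal]) (simp_all add: keys_add_nat)
  then have "monom (s + unit_exp u) - monom t' \<in> I"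
    by (simp add: t0 right_diff_distrib mult_single add.commute)
  from poly_ideal_add[OF I_ideal this poly_ideal_uminus[OF I_ideal diff]] show ?case by simp
qed

theorem crossed_strips_prime: "primeideal (polyomino_ideal P :: (point, 'k) mpoly set) (polyomino_ring P)"
  unfolding polyomino_ring_def I_def[symmetric]
  by (rule toric_ideal_prime[where \<Phi> = \<Phi>])
    (fact I_ideal, fact \<Phi>_add, erule I_kernel, rule binomial_in_ideal)

end

section \<open>Grid polyominoes\<close>

text \<open>The shape of a grid polyomino: all cells of the rectangle with corners \<open>(1, 1)\<close> and \<open>(m, n)\<close>
  lying on one of the strips. The lower bounds on \<open>m\<close> and \<open>n\<close> are imposed only if both families of
  strips are non-empty, since a grid without holes is a single strip.\<close>

definition grid_form :: "(nat \<Rightarrow> nat \<Rightarrow> bool) \<Rightarrow> nat \<Rightarrow> nat \<Rightarrow> nat set \<Rightarrow> nat set \<Rightarrow> bool" where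
  "grid_form C m n X Y \<longleftrightarrow>
     (\<forall>x y. C x y \<longleftrightarrow> 1 \<le> x \<and> x < m \<and> 1 \<le> y \<and> y < n \<and> (x \<in> X \<or> y \<in> Y)) \<and>
     X \<subseteq> {1..<m} \<and> Y \<subseteq> {1..<n} \<and>
     (\<forall>x\<in>X. Suc x \<notin> X) \<and> (\<forall>y\<in>Y. Suc y \<notin> Y) \<and>
     (X \<noteq> {} \<and> Y \<noteq> {} \<longrightarrow> 3 \<le> m \<and> 3 \<le> n)"

lemma grid_form_transpose: "grid_form C m n X Y \<Longrightarrow> grid_form (\<lambda>y x. C x y) n m Y X"
  by (auto simp: grid_form_def)

text \<open>The holes form a product arrangement, so that a cell is outside of all holes iff its abscissa is
  outside of all their horizontal extents or its ordinate is outside of all their vertical extents.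
  Thinness forces the strips between the holes to have width one.\<close>

lemma grid_polyomino_form:
  assumes "grid_polyomino P"
  shows "\<exists>m n X Y. grid_form (\<lambda>x y. cell (x, y) \<in> P) m n X Y"
proof -
  obtain m n r s :: nat and a b :: "nat \<Rightarrow> nat \<Rightarrow> point"
    where P: "P = {C \<in> cells. C \<subseteq> interval (1, 1) (m, n) \<and>
               (\<forall>i\<in>{1..r}. \<forall>j\<in>{1..s}. \<not> C \<subseteq> interval (a i j) (b i j))}"
      and size: "\<forall>i\<in>{1..r}. \<forall>j\<in>{1..s}.
           1 < fst (a i j) \<and> fst (a i j) < fst (b i j) \<and> fst (b i j) < m \<and>
           1 < snd (a i j) \<and> snd (a i j) < snd (b i j) \<and> snd (b i j) < n"
      and cols: "\<forall>i\<in>{1..r}. \<forall>l\<in>{1..s}. \<forall>k\<in>{1..s}.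
           fst (a i l) = fst (a i k) \<and> fst (b i l) = fst (b i k)"
      and rows: "\<forall>j\<in>{1..s}. \<forall>l\<in>{1..r}. \<forall>k\<in>{1..r}.
           snd (a l j) = snd (a k j) \<and> snd (b l j) = snd (b k j)"
    using assms unfolding grid_polyomino_def by blast
  have thin: "\<not> (cell (x, y) \<in> P \<and> cell (Suc x, y) \<in> P \<and> cell (x, Suc y) \<in> P \<and> cell (Suc x, Suc y) \<in> P)"
    for x y
    using assms unfolding grid_polyomino_def thin_def by auto
  have cell_P: "cell (x, y) \<in> P \<longleftrightarrow> 1 \<le> x \<and> x < m \<and> 1 \<le> y \<and> y < n \<and>
      (\<forall>i\<in>{1..r}. \<forall>j\<in>{1..s}. \<not> (fst (a i j) \<le> x \<and> x < fst (b i j) \<and> snd (a i j) \<le> y \<and> y < snd (b i j)))"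
    for x y
    unfolding P by (auto simp: cells_def cell_subset_interval)
  show ?thesis
  proof (cases "1 \<le> r \<and> 1 \<le> s")
    case True
    define X where "X = {x. 1 \<le> x \<and> x < m \<and> (\<forall>i\<in>{1..r}. \<not> (fst (a i 1) \<le> x \<and> x < fst (b i 1)))}"
    define Y where "Y = {y. 1 \<le> y \<and> y < n \<and> (\<forall>j\<in>{1..s}. \<not> (snd (a 1 j) \<le> y \<and> y < snd (b 1 j)))}"
    have eqs: "fst (a i j) = fst (a i 1)" "fst (b i j) = fst (b i 1)"
      "snd (a i j) = snd (a 1 j)" "snd (b i j) = snd (b 1 j)" if "i \<in> {1..r}" "j \<in> {1..s}" for i j
    proof -
      have "1 \<in> {1..r}" "1 \<in> {1..s}" using True by auto
      then show "fst (a i j) = fst (a i 1)" "fst (b i j) = fst (b i 1)"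
        "snd (a i j) = snd (a 1 j)" "snd (b i j) = snd (b 1 j)"
        using cols rows that by blast+
    qed
    have C: "cell (x, y) \<in> P \<longleftrightarrow> 1 \<le> x \<and> x < m \<and> 1 \<le> y \<and> y < n \<and> (x \<in> X \<or> y \<in> Y)" for x y
    proof -
      have "(\<forall>i\<in>{1..r}. \<forall>j\<in>{1..s}. \<not> (fst (a i j) \<le> x \<and> x < fst (b i j) \<and> snd (a i j) \<le> y \<and> y < snd (b i j)))
        \<longleftrightarrow> (\<forall>i\<in>{1..r}. \<forall>j\<in>{1..s}. \<not> (fst (a i 1) \<le> x \<and> x < fst (b i 1) \<and> snd (a 1 j) \<le> y \<and> y < snd (b 1 j)))"
        by (intro ball_cong refl) (use eqs in metis)
      then show ?thesis unfolding cell_P X_def Y_def by blast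
    qed
    \<comment> \<open>There is a hole, so a strip contains the cells at both 1 and 2, and two
      consecutive strips would contain a square.\<close>
    have big: "4 \<le> m" "4 \<le> n"
      using size[rule_format, of 1 1] True by auto
    have "Suc x \<notin> X" if "x \<in> X" for x
    proof
      assume "Suc x \<in> X"
      then show False using thin[of x 1] that big unfolding C by (auto simp: X_def)
    qed
    moreover have "Suc y \<notin> Y" if "y \<in> Y" for y
    proof
      assume "Suc y \<in> Y"
      then show False using thin[of 1 y] that big unfolding C by (auto simp: Y_def)
    qed
    moreover have "X \<subseteq> {1..<m}" "Y \<subseteq> {1..<n}" by (auto simp: X_def Y_def)
    ultimately have "grid_form (\<lambda>x y. cell (x, y) \<in> P) m n X Y"
      unfolding grid_form_def using C big by simp
    then show ?thesis by blast
  next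
    case False
    then have C: "cell (x, y) \<in> P \<longleftrightarrow> 1 \<le> x \<and> x < m \<and> 1 \<le> y \<and> y < n" for x y
      unfolding cell_P by auto
    \<comment> \<open>Without holes the polyomino is a full rectangle, which is thin only if it is a single strip.\<close>
    have "m \<le> 2 \<or> n \<le> 2"
      using thin[of 1 1] unfolding C by auto
    then have "grid_form (\<lambda>x y. cell (x, y) \<in> P) m n {1..<m} {} \<or>
        grid_form (\<lambda>x y. cell (x, y) \<in> P) m n {} {1..<n}"
      unfolding grid_form_def C by auto
    then show ?thesis by blast
  qed
qed

text \<open>A full strip is a maximal inner interval: a larger one would contain two vertically adjacent
  cells of a neighbouring column that is not a strip, and these would lie on consecutive horizontal
  strips.\<close>

lemma strip_block_maximal:
  assumes form: "grid_form C m n X Y" and x: "x \<in> X" and n: "3 \<le> n"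
    and blk: "block C a b"
    and ab: "fst a \<le> x" "Suc x \<le> fst b" "snd a \<le> 1" "n \<le> snd b"
  shows "a = (x, 1) \<and> b = (Suc x, n)"
proof -
  have C: "C i j \<longleftrightarrow> 1 \<le> i \<and> i < m \<and> 1 \<le> j \<and> j < n \<and> (i \<in> X \<or> j \<in> Y)" for i j
    using form unfolding grid_form_def by blast
  have sparse: "i \<in> X \<Longrightarrow> Suc i \<notin> X" "j \<in> Y \<Longrightarrow> Suc j \<notin> Y" for i j
    using form unfolding grid_form_def by blast+
  have in_C: "C i j" if "fst a \<le> i" "i < fst b" "snd a \<le> j" "j < snd b" for i j
    using blk that ab n by (auto simp: block_def)
  have "1 \<le> snd a" using in_C[of x "snd a"] ab n unfolding C by simp
  moreover have "snd b \<le> n"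
  proof -
    have "C x (snd b - 1)" by (rule in_C) (use ab n in linarith)+
    then have "snd b - 1 < n" unfolding C by blast
    then show ?thesis by linarith
  qed
  moreover have not_both: "\<not> (C i 1 \<and> C i 2)" if "i \<notin> X" for i
    unfolding C using that sparse(2)[of 1] by (auto simp: numeral_2_eq_2)
  moreover have "\<not> fst a < x"
  proof
    assume "fst a < x"
    then have "C (x - 1) 1" "C (x - 1) 2" using in_C ab n by auto
    moreover have "x - 1 \<notin> X" using sparse(1)[of "x - 1"] x \<open>fst a < x\<close> by auto
    ultimately show False using not_both by blast
  qed
  moreover have "\<not> Suc x < fst b"
  proof
    assume "Suc x < fst b"
    then have "C (Suc x) 1" "C (Suc x) 2" using in_C ab n by auto
    then show False using not_both sparse(1)[OF x] by blast
  qed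
  ultimately show ?thesis using ab by (simp add: prod_eq_iff)
qed

lemma interval_subset_iff:
  assumes "fst a \<le> fst b" "snd a \<le> snd b"
  shows "interval a b \<subseteq> interval c d \<longleftrightarrow>
    fst c \<le> fst a \<and> fst b \<le> fst d \<and> snd c \<le> snd a \<and> snd b \<le> snd d"
  using assms by (auto simp: interval_def times_subset_iff)

lemma crossing_not_single:
  assumes form: "grid_form (\<lambda>x y. cell (x, y) \<in> P) m n X Y" and x: "x \<in> X" and y: "y \<in> Y"
  shows "cell (x, y) \<notin> single_interval_cells P"
proof
  let ?C = "\<lambda>x y. cell (x, y) \<in> P"
  let ?V = "interval (x, 1) (Suc x, n)" and ?H = "interval (1, y) (m, Suc y)"
  assume "cell (x, y) \<in> single_interval_cells P"
  then have "card {J \<in> maximal_inner_intervals P. cell (x, y) \<subset> J} = 1"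
    by (simp add: single_interval_cells_def)
  then obtain J where J: "{J \<in> maximal_inner_intervals P. cell (x, y) \<subset> J} = {J}"
    by (auto simp: card_1_singleton_iff)
  have C: "?C i j \<longleftrightarrow> 1 \<le> i \<and> i < m \<and> 1 \<le> j \<and> j < n \<and> (i \<in> X \<or> j \<in> Y)" for i j
    using form unfolding grid_form_def by blast
  have big: "3 \<le> m" "3 \<le> n" and xy: "1 \<le> x" "x < m" "1 \<le> y" "y < n"
    using form x y unfolding grid_form_def by auto
  have "?V \<in> inner_intervals P"
    using xy big x unfolding inner_intervals_def inner_interval_block
    by (auto simp: proper_interval_def block_def C less_Suc_eq_le intro!: exI)
  moreover have "\<not> ?V \<subset> J'" if mem: "J' \<in> inner_intervals P" for J'
  proof
    assume sub: "?V \<subset> J'"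
    obtain a b where J': "J' = interval a b" and "block ?C a b"
      using mem by (auto simp: inner_intervals_def inner_interval_block)
    moreover have "fst a \<le> x" "Suc x \<le> fst b" "snd a \<le> 1" "n \<le> snd b"
      using psubset_imp_subset[OF sub] big unfolding J' by (simp_all add: interval_subset_iff)
    ultimately show False
      using strip_block_maximal[OF form x big(2)] sub by blast
  qed
  ultimately have "?V \<in> maximal_inner_intervals P"
    by (auto simp: maximal_inner_intervals_def)
  moreover have "?H \<in> inner_intervals P"
    using xy big y unfolding inner_intervals_def inner_interval_block
    by (auto simp: proper_interval_def block_def C less_Suc_eq_le intro!: exI)
  moreover have "\<not> ?H \<subset> J'" if mem: "J' \<in> inner_intervals P" for J'
  proof
    assume sub: "?H \<subset> J'"
    obtain a b where J': "J' = interval a b" and blk: "block ?C a b"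
      using mem by (auto simp: inner_intervals_def inner_interval_block)
    have "block (\<lambda>j i. ?C i j) (prod.swap a) (prod.swap b)"
      using blk by (simp only: block_transpose)
    moreover have "snd a \<le> y" "Suc y \<le> snd b" "fst a \<le> 1" "m \<le> fst b"
      using psubset_imp_subset[OF sub] big unfolding J' by (simp_all add: interval_subset_iff)
    ultimately have "prod.swap a = (y, 1) \<and> prod.swap b = (Suc y, m)"
      by (intro strip_block_maximal[OF grid_form_transpose[OF form] y big(1)]) simp_all
    then have "a = (1, y) \<and> b = (m, Suc y)" by (simp add: prod_eq_iff)
    then show False using sub unfolding J' by blast
  qed
  ultimately have "?H \<in> maximal_inner_intervals P"
    by (auto simp: maximal_inner_intervals_def)
  have "cell (x, y) = interval (x, y) (Suc x, Suc y)" by (simp add: cell_def)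
  then have "cell (x, y) \<subset> ?V" "cell (x, y) \<subset> ?H"
    using xy big by (simp_all add: less_le_not_le interval_subset_iff)
  then have "?V \<in> {J}" "?H \<in> {J}"
    using \<open>?V \<in> maximal_inner_intervals P\<close> \<open>?H \<in> maximal_inner_intervals P\<close>
    unfolding J[symmetric] by simp_all
  moreover have "\<not> ?V \<subseteq> ?H"
    using xy big by (simp add: interval_subset_iff)
  ultimately show False by simp
qed

lemma subgrid_crossed_strips:
  assumes "grid_polyomino P" and "subgrid_polyomino P P'"
  shows "\<exists>X Y. crossed_strips X Y (\<lambda>x y. cell (x, y) \<in> P')"
proof -
  obtain m n X Y where form: "grid_form (\<lambda>x y. cell (x, y) \<in> P) m n X Y"
    using grid_polyomino_form[OF assms(1)] by blast
  obtain Q where Q: "Q \<subseteq> single_interval_cells P" "P' = P - Q"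
    using assms(2) by (auto simp: subgrid_polyomino_def)
  have "cell (x, y) \<in> P'" if "x \<in> X" "y \<in> Y" for x y
  proof -
    have "cell (x, y) \<in> P" using form that unfolding grid_form_def by auto
    then show ?thesis using crossing_not_single[OF form that] Q by blast
  qed
  then have "crossed_strips X Y (\<lambda>x y. cell (x, y) \<in> P')"
    using form Q(2) unfolding grid_form_def crossed_strips_def by blast
  then show ?thesis by blast
qed

theorem corollary3p9:
  fixes P P' :: "point set set"
  assumes "grid_polyomino P"
    and "subgrid_polyomino P P'"
  shows "primeideal (polyomino_ideal P' :: (point, 'k::field) mpoly set) (polyomino_ring P')"
proof -
  obtain X Y where "crossed_strips X Y (\<lambda>x y. cell (x, y) \<in> P')"
    using subgrid_crossed_strips[OF assms] by blast
  then show ?thesis by (rule crossed_strips_prime)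
qed

end
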